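(* Let $x,y$ be roots of unity with $x\neq1$, let $a\in\mathbb{C}\setminus\mathbb{Z}$, and let $p,q\ge1$ be integers with $(p,y)\neq(1,1)$ and $(q,xy)\ne(1,1)$. Then \begin{align*} &x\, S_{p;q}^{(a-1)}\big(y;(xy)^{-1}\big)-(-1)^{p+q} S_{p;q}^{(-a)}\big(y^{-1};xy\big)\\ &=x\,\mathrm{Li}_{p}(y;a)\mathrm{Li}_q\big((xy)^{-1};a\big)+(-1)^{q} y^{-1}\mathrm{Li}_p(y;a)\mathrm{Li}_q(xy;1-a)+(-1)^{p+q-1}\mathrm{Li}_{p+q}(x;1-a)\\ &\quad+(-1)^q \sum_{m=0}^{p-1}\binom{p+q-m-2}{q-1}\left((-1)^m \mathrm{Li}_{m+1}(x;1-a)-x\mathrm{Li}_{m+1}\big(x^{-1};a\big)\right)\mathrm{Li}_{p+q-m-1}(xy)\\ &\quad+(-1)^q \sum_{m=0}^{q-1}\binom{p+q-m-2}{p-1}\left((-1)^m x\mathrm{Li}_{m+1}\big(x^{-1};a\big)-\mathrm{Li}_{m+1}(x;1-a)\right)\mathrm{Li}_{p+q-m-1}(y). \end{align*}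
   Context: For $|w|\le1$, $m\in\mathbb{N}$ with $(m,w)\ne(1,1)$ and $b\in\mathbb{C}\setminus\{0,-1,-2,\dots\}$: $\mathrm{Li}_m(w;b)=\sum_{n\ge1}\frac{w^n}{(n+b-1)^m}$ and $\mathrm{Li}_m(w)=\sum_{n\ge1}\frac{w^n}{n^m}$. For $n\ge0$: $\zeta_n(p;w;b)=\sum_{k=1}^n\frac{w^k}{(k+b)^p}$. For roots of unity $u,v$, $p,q\in\mathbb{N}$ with $(q,v)\ne(1,1)$ and $b\in\mathbb{C}\setminus\mathbb{Z}$, the Hurwitz-type cyclotomic Euler $S$-sum is $S^{(b)}_{p;q}(u;v)=\sum_{n\ge1}\frac{\zeta_n(p;u;b)}{(n+b)^q}v^n$. *)

theory Defs
  imports "HOL-Analysis.Analysis"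
begin

definition is_root_of_unity :: "complex \<Rightarrow> bool" where
  "is_root_of_unity z \<longleftrightarrow> (\<exists>n::nat. n > 0 \<and> z ^ n = 1)"

text \<open>
  All infinite series run over $n \ge 1$, written here with the shifted index \<open>Suc n\<close>.
  They are limits of partial sums in the natural order (\<open>suminf\<close>, not \<open>infsum\<close>), because
  for exponent 1 and argument on the unit circle they converge only conditionally.
  The functions are total; they have their intended meaning for $|w| \le 1$, exponents
  at least 1, $(m, w) \ne (1, 1)$ and parameters $b$ for which no denominator vanishes.
\<close>

definition Li :: "nat \<Rightarrow> complex \<Rightarrow> complex" where
  "Li m w = (\<Sum>n. w ^ Suc n / of_nat (Suc n) ^ m)"

definition Li_Hurwitz :: "nat \<Rightarrow> complex \<Rightarrow> complex \<Rightarrow> complex" where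
  "Li_Hurwitz m w b = (\<Sum>n. w ^ Suc n / (of_nat (Suc n) + b - 1) ^ m)"

text \<open>
  The denominator is $(k+b)^p$ here, whereas it is $(n+b-1)^m$ in \<open>Li_Hurwitz\<close>.
\<close>

definition zeta_partial :: "nat \<Rightarrow> nat \<Rightarrow> complex \<Rightarrow> complex \<Rightarrow> complex" where
  "zeta_partial n p w b = (\<Sum>k=1..n. w ^ k / (of_nat k + b) ^ p)"

text \<open>\<open>euler_S b p q u v\<close> is $S^{(b)}_{p;q}(u;v)$.\<close>

definition euler_S :: "complex \<Rightarrow> nat \<Rightarrow> nat \<Rightarrow> complex \<Rightarrow> complex \<Rightarrow> complex" where
  "euler_S b p q u v =
     (\<Sum>n. zeta_partial (Suc n) p u b / (of_nat (Suc n) + b) ^ q * v ^ Suc n)"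

end

theory Submission
  imports Defs
begin

text \<open>
  Put $F(K,N) = y^K (xy)^{-N} / ((K+a)^p (N+a)^q)$ for integers $K, N$. After shifting the
  indices and reflecting $n \mapsto -n$ in all series with parameter $-a$ or $1-a$, the two Euler
  sums, the two products and $\mathrm{Li}_{p+q}(x;1-a)$ are sums of $F$ over sectors and half
  diagonals of the integer lattice, and together they amount to the sum of $F$ over the half plane
  $K > N$. Sorting this half plane by $j = K - N \ge 1$ and expanding $1/((X+j)^p X^q)$, $X = N+a$,
  into partial fractions factors it into the values $\mathrm{Li}_s(xy)$, $\mathrm{Li}_s(y)$ and the
  bilateral sums $\sum_N x^{-N}/(N+a)^i$, which are the remaining terms. As the series converge only
  conditionally, both evaluations are carried out on the triangle $-M \le N < K < M$, and
  $M \to \infty$; boundedness of the partial sums of $x^{-N}$ (as $x \ne 1$) controls the errors.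
\<close>

section \<open>Convergence by summation by parts\<close>

text \<open>For complex terms the bound on increments takes the place of monotonicity in Dirichlet's
  test. The product of consecutive integers is chosen because it telescopes.\<close>

definition decay :: "(nat \<Rightarrow> complex) \<Rightarrow> bool" where
  "decay u \<longleftrightarrow> (\<exists>c. \<forall>n. norm (u n) \<le> c / real (Suc n) \<and>
     norm (u (Suc n) - u n) \<le> c / (real (Suc n) * real (Suc (Suc n))))"

lemma decayI:
  assumes "\<And>n. norm (u n) \<le> c / real (Suc n)"
    and "\<And>n. norm (u (Suc n) - u n) \<le> d / (real (Suc n) * real (Suc (Suc n)))"
  shows "decay u"
  unfolding decay_def
proof (intro exI allI conjI)
  fix n
  show "norm (u n) \<le> max c d / real (Suc n)"
    by (rule order_trans[OF assms(1)]) (intro divide_right_mono, auto)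
  show "norm (u (Suc n) - u n) \<le> max c d / (real (Suc n) * real (Suc (Suc n)))"
    by (rule order_trans[OF assms(2)]) (intro divide_right_mono, auto)
qed

text \<open>Discrete product rule. The hypotheses on \<open>z\<close> are those of bounded partial
  sums of a series with terms of order 1/n, which is how Euler sums are reached.\<close>

lemma decay_mult:
  assumes z: "\<And>n. norm (z n) \<le> c" and dz: "\<And>n. norm (z (Suc n) - z n) \<le> d / real (Suc n)"
    and u: "decay u"
  shows "decay (\<lambda>n. z n * u n)"
proof -
  obtain e where e1: "\<And>n. norm (u n) \<le> e / real (Suc n)"
    and e2: "\<And>n. norm (u (Suc n) - u n) \<le> e / (real (Suc n) * real (Suc (Suc n)))"
    using u unfolding decay_def by blast
  have c0: "0 \<le> c" using z[of 0] norm_ge_zero[of "z 0"] by linarith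
  have d0: "0 \<le> d" using order_trans[OF norm_ge_zero dz[of 0]] by simp
  show ?thesis
  proof (rule decayI)
    fix n
    have "norm (z n * u n) \<le> c * (e / real (Suc n))"
      unfolding norm_mult by (intro mult_mono z e1 c0) auto
    then show "norm (z n * u n) \<le> c * e / real (Suc n)" by simp
    have "z (Suc n) * u (Suc n) - z n * u n
        = (z (Suc n) - z n) * u (Suc n) + z n * (u (Suc n) - u n)"
      by (simp add: algebra_simps)
    also have "norm \<dots> \<le> norm (z (Suc n) - z n) * norm (u (Suc n)) + norm (z n) * norm (u (Suc n) - u n)"
      by (metis norm_triangle_ineq norm_mult)
    also have "\<dots> \<le> (d / real (Suc n)) * (e / real (Suc (Suc n)))
        + c * (e / (real (Suc n) * real (Suc (Suc n))))"
      by (intro add_mono mult_mono z dz e1 e2 c0) (use d0 in auto)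
    also have "\<dots> = (d * e + c * e) / (real (Suc n) * real (Suc (Suc n)))"
      by (simp add: add_divide_distrib)
    finally show "norm (z (Suc n) * u (Suc n) - z n * u n)
        \<le> (d * e + c * e) / (real (Suc n) * real (Suc (Suc n)))" .
  qed
qed

lemma decay_mult_decay:
  assumes "decay z" "decay u"
  shows "decay (\<lambda>n. z n * u n)"
proof -
  obtain e where e1: "\<And>n. norm (z n) \<le> e / real (Suc n)"
    and e2: "\<And>n. norm (z (Suc n) - z n) \<le> e / (real (Suc n) * real (Suc (Suc n)))"
    using assms(1) unfolding decay_def by blast
  have e0: "0 \<le> e" using order_trans[OF norm_ge_zero e1[of 0]] by simp
  show ?thesis
  proof (rule decay_mult[OF _ _ assms(2)])
    fix n
    show "norm (z n) \<le> e"
      using e0 by (intro order_trans[OF e1]) (simp add: divide_le_eq mult_le_cancel_left1)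
    show "norm (z (Suc n) - z n) \<le> e / real (Suc n)"
      using e0 by (intro order_trans[OF e2] divide_left_mono) (auto simp: mult_le_cancel_left1)
  qed
qed

text \<open>For n > 2|b| + 1 the triangle inequality suffices; the finitely many remaining quotients
  are positive and have a positive minimum.\<close>

lemma shifted_norm_ge:
  fixes b :: complex
  assumes "\<And>n. of_nat n + b \<noteq> 0"
  obtains d where "d > 0" "\<And>n. d * real (Suc n) \<le> norm (of_nat n + b)"
proof -
  define r where "r n = norm (of_nat n + b) / real (Suc n)" for n
  obtain m :: nat where m: "real m > 2 * norm b + 1" using reals_Archimedean2 by blast
  \<comment> \<open>The entry 1/2 forces d <= 1/4, the constant available for n >= m.\<close>
  define d where "d = Min (insert (1/2) (r ` {..<m})) / 2"
  have rpos: "r n > 0" for n using assms[of n] by (simp add: r_def)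
  have dpos: "d > 0" unfolding d_def using rpos by (simp add: Min_gr_iff)
  have dr: "d \<le> r n / 2" if "n < m" for n
    unfolding d_def using that by (intro divide_right_mono Min_le) auto
  have dh: "d \<le> 1/4"
  proof -
    have "Min (insert (1/2) (r ` {..<m})) \<le> 1/2" by (intro Min_le) auto
    then show ?thesis by (simp add: d_def)
  qed
  have "d * real (Suc n) \<le> norm (of_nat n + b)" for n
  proof (cases "n < m")
    case True
    have "d \<le> r n" using dr[OF True] rpos[of n] by simp
    then show ?thesis by (simp add: r_def field_simps)
  next
    case False
    then have "real n \<ge> real m" by simp
    have "real n - norm b \<le> norm (of_nat n + b)"
      using norm_triangle_ineq2[of "of_nat n :: complex" "- b"] by simp
    moreover have "1/4 * real (Suc n) \<le> real n - norm b"
      using m \<open>real n \<ge> real m\<close> norm_ge_zero[of b] by simp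
    moreover have "d * real (Suc n) \<le> 1/4 * real (Suc n)"
      using dh by (intro mult_right_mono) auto
    ultimately show ?thesis by linarith
  qed
  with dpos show ?thesis using that by blast
qed

lemma decay_inverse_shifted:
  fixes b :: complex
  assumes b: "\<And>n. of_nat n + b \<noteq> 0"
  shows "decay (\<lambda>n. 1 / (of_nat n + b))"
proof -
  obtain d where d: "d > 0" "\<And>n. d * real (Suc n) \<le> norm (of_nat n + b)"
    using shifted_norm_ge[OF b] by blast
  have *: "norm (1 / (of_nat n + b)) \<le> (1 / d) / real (Suc n)" for n
  proof -
    have "1 / norm (of_nat n + b) \<le> 1 / (d * real (Suc n))"
      using d by (intro divide_left_mono mult_pos_pos) (auto simp: b)
    then show ?thesis by (simp add: norm_divide)
  qed
  show ?thesis
  proof (rule decayI[OF *])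
    fix n
    have "1 / (of_nat (Suc n) + b) - 1 / (of_nat n + b)
        = - (1 / (of_nat n + b) * (1 / (of_nat (Suc n) + b)))"
      using b[of n] b[of "Suc n"] by (simp add: field_simps)
    then have "norm (1 / (of_nat (Suc n) + b) - 1 / (of_nat n + b))
        = norm (1 / (of_nat n + b)) * norm (1 / (of_nat (Suc n) + b))"
      by (simp only: norm_minus_cancel norm_mult)
    also have "\<dots> \<le> ((1 / d) / real (Suc n)) * ((1 / d) / real (Suc (Suc n)))"
      using d(1) by (intro mult_mono *) auto
    finally show "norm (1 / (of_nat (Suc n) + b) - 1 / (of_nat n + b))
        \<le> (1 / d) * (1 / d) / (real (Suc n) * real (Suc (Suc n)))"
      by (simp only: times_divide_times_eq)
  qed
qed

lemma decay_inverse_shifted_power: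
  fixes b :: complex
  assumes b: "\<And>n. of_nat n + b \<noteq> 0" and i: "i \<ge> 1"
  shows "decay (\<lambda>n. 1 / (of_nat n + b) ^ i)"
  using i
proof (induction i rule: nat_induct_at_least)
  case base
  show ?case using decay_inverse_shifted[OF b] by simp
next
  case (Suc i)
  show ?case using decay_mult_decay[OF decay_inverse_shifted[OF b] Suc.IH] by simp
qed

text \<open>Meant for w = 1, where nothing oscillates: exponents at least 2 give absolute
  convergence by comparison with 1/n^2.\<close>

lemma norm_inverse_shifted_power_le:
  fixes b :: complex
  assumes b: "\<And>n. of_nat n + b \<noteq> 0" and i: "i \<ge> 2"
  obtains c where "\<And>n. norm (1 / (of_nat n + b) ^ i) \<le> c / real (Suc n) ^ 2"
proof -
  obtain c where c: "\<And>n. norm (1 / (of_nat n + b)) \<le> c / real (Suc n)"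
    using decay_inverse_shifted[OF b] unfolding decay_def by blast
  obtain e where e: "\<And>n. norm (1 / (of_nat n + b) ^ (i - 1)) \<le> e / real (Suc n)"
    using decay_inverse_shifted_power[OF b, of "i - 1"] i unfolding decay_def by force
  have c0: "0 \<le> c" using order_trans[OF norm_ge_zero c[of 0]] by simp
  have "norm (1 / (of_nat n + b) ^ i) \<le> c * e / real (Suc n) ^ 2" for n
  proof -
    have "1 / (of_nat n + b) ^ i = 1 / (of_nat n + b) * (1 / (of_nat n + b) ^ (i - 1))"
      using i by (cases i) auto
    then have "norm (1 / (of_nat n + b) ^ i)
        = norm (1 / (of_nat n + b)) * norm (1 / (of_nat n + b) ^ (i - 1))"
      by (simp only: norm_mult)
    also have "\<dots> \<le> (c / real (Suc n)) * (e / real (Suc n))"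
      by (intro mult_mono c e) (use c0 in auto)
    finally show ?thesis by (simp add: power2_eq_square)
  qed
  then show ?thesis using that by blast
qed

text \<open>Multiplication by 1 - w subtracts a shifted copy of the sum, so that only boundary terms
  and increments of \<open>u\<close> survive.\<close>

lemma summation_by_parts_power:
  fixes u :: "nat \<Rightarrow> complex"
  assumes "l \<le> h"
  shows "(1 - w) * (\<Sum>n=l..<h. u n * w ^ n)
    = u l * w ^ l - u h * w ^ h + (\<Sum>n=l..<h. (u (Suc n) - u n) * w ^ Suc n)"
  using assms
proof (induction h rule: dec_induct)
  case (step h)
  have "(1 - w) * (\<Sum>n=l..<Suc h. u n * w ^ n)
      = (1 - w) * (\<Sum>n=l..<h. u n * w ^ n) + (1 - w) * (u h * w ^ h)"
    using step.hyps by (simp add: sum.atLeastLessThan_Suc distrib_left)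
  also have "\<dots> = u l * w ^ l - u (Suc h) * w ^ Suc h
      + ((\<Sum>n=l..<h. (u (Suc n) - u n) * w ^ Suc n) + (u (Suc h) - u h) * w ^ Suc h)"
    unfolding step.IH by (simp add: left_diff_distrib)
  finally show ?case using step.hyps by (simp add: sum.atLeastLessThan_Suc)
qed simp

text \<open>The bound is uniform in the end h of the block. The rate in l is recorded because
  truncation errors are summed over many windows later, which mere convergence would not
  control.\<close>

definition tail_bound :: "(nat \<Rightarrow> complex) \<Rightarrow> real \<Rightarrow> bool" where
  "tail_bound f C \<longleftrightarrow> (\<forall>l h. l \<le> h \<longrightarrow> norm (\<Sum>n=l..<h. f n) \<le> C / real (Suc l))"

text \<open>The boundary terms contribute e/(l+1) + e/(h+1) and the telescoping increments e/(l+1) -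
  e/(h+1); hence the constant 2e/|1 - w|.\<close>

lemma decay_tail_bound:
  assumes u: "decay u" and w: "norm w = 1" "w \<noteq> 1"
  obtains C where "tail_bound (\<lambda>n. u n * w ^ n) C"
proof -
  obtain e where e1: "\<And>n. norm (u n) \<le> e / real (Suc n)"
    and e2: "\<And>n. norm (u (Suc n) - u n) \<le> e / (real (Suc n) * real (Suc (Suc n)))"
    using u unfolding decay_def by blast
  have "norm (\<Sum>n=l..<h. u n * w ^ n) \<le> (2 * e / norm (1 - w)) / real (Suc l)" if lh: "l \<le> h" for l h
  proof -
    have tel: "(\<Sum>n=l..<h. e / (real (Suc n) * real (Suc (Suc n)))) = e / real (Suc l) - e / real (Suc h)"
    proof -
      have "e / (real (Suc n) * real (Suc (Suc n))) = - (e / real (Suc (Suc n)) - e / real (Suc n))" for n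
        by (simp add: field_simps)
      then show ?thesis using sum_Suc_diff'[OF lh, of "\<lambda>n. - (e / real (Suc n))"] by simp
    qed
    have "norm (1 - w) * norm (\<Sum>n=l..<h. u n * w ^ n)
        = norm (u l * w ^ l - u h * w ^ h + (\<Sum>n=l..<h. (u (Suc n) - u n) * w ^ Suc n))"
      by (simp only: summation_by_parts_power[OF lh, symmetric] norm_mult)
    also have "\<dots> \<le> norm (u l * w ^ l) + norm (u h * w ^ h)
        + norm (\<Sum>n=l..<h. (u (Suc n) - u n) * w ^ Suc n)"
      by (intro order_trans[OF norm_triangle_ineq] add_right_mono norm_triangle_ineq4)
    also have "\<dots> \<le> e / real (Suc l) + e / real (Suc h)
        + (\<Sum>n=l..<h. e / (real (Suc n) * real (Suc (Suc n))))"
      using e1 e2 w(1)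
      by (intro add_mono sum_norm_le) (auto simp: norm_mult norm_power simp del: of_nat_Suc)
    also have "\<dots> = 2 * e / real (Suc l)" unfolding tel by simp
    finally have "norm (\<Sum>n=l..<h. u n * w ^ n) \<le> 2 * e / real (Suc l) / norm (1 - w)"
      using w(2) by (subst pos_le_divide_eq) (auto simp: mult.commute)
    then show ?thesis by (simp only: divide_divide_eq_left mult.commute)
  qed
  then show ?thesis using that unfolding tail_bound_def by blast
qed

lemma tail_bound_summable:
  assumes "tail_bound f C"
  shows "summable f"
  unfolding summable_Cauchy
proof (intro allI impI)
  fix e :: real assume e: "e > 0"
  obtain N :: nat where N: "real N > C / e" using reals_Archimedean2 by blast
  have "norm (sum f {m..<n}) < e" if "m \<ge> N" for m n
  proof (cases "m \<le> n")
    case True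
    have "norm (sum f {m..<n}) \<le> C / real (Suc m)" using assms True by (simp add: tail_bound_def)
    also have "\<dots> < e"
    proof -
      have "C / e < real (Suc m)" using N that by simp
      then show ?thesis using e by (simp add: field_simps)
    qed
    finally show ?thesis .
  qed (use e in simp)
  then show "\<exists>N. \<forall>m\<ge>N. \<forall>n. norm (sum f {m..<n}) < e" by blast
qed

text \<open>Letting h tend to infinity in the block bound turns it into a rate of
  convergence.\<close>

lemma tail_bound_error:
  assumes t: "tail_bound f C" and s: "f sums s"
  shows "norm (sum f {..<n} - s) \<le> C / real (Suc n)"
proof -
  have "(\<lambda>h. norm (sum f {..<n} - sum f {..<h})) \<longlonglongrightarrow> norm (sum f {..<n} - s)"
    using s unfolding sums_def by (intro tendsto_intros)
  moreover have "\<forall>h\<ge>n. norm (sum f {..<n} - sum f {..<h}) \<le> C / real (Suc n)"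
  proof (intro allI impI)
    fix h assume h: "n \<le> h"
    have "sum f {..<h} = sum f {..<n} + sum f {n..<h}"
      using h sum.atLeastLessThan_concat[of 0 n h f] by (simp add: atLeast0LessThan)
    then show "norm (sum f {..<n} - sum f {..<h}) \<le> C / real (Suc n)"
      using t h by (simp add: tail_bound_def del: of_nat_Suc)
  qed
  ultimately show ?thesis by (intro Lim_bounded[of _ _ n]) auto
qed

text \<open>If w \<noteq> 1, oscillation gives convergence for every i >= 1; if w = 1, the excluded
  pair forces i >= 2 and convergence is absolute.\<close>

lemma summable_power_over_shifted_power:
  fixes b w :: complex
  assumes b: "\<And>n. of_nat n + b \<noteq> 0" and i: "i \<ge> 1" and w: "norm w = 1" and iw: "(i, w) \<noteq> (1, 1)"
  shows "summable (\<lambda>n. w ^ n / (of_nat n + b) ^ i)"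
proof (cases "w = 1")
  case False
  obtain C where "tail_bound (\<lambda>n. 1 / (of_nat n + b) ^ i * w ^ n) C"
    using decay_tail_bound[OF decay_inverse_shifted_power[OF b i] w False] by blast
  from tail_bound_summable[OF this] show ?thesis by simp
next
  case True
  then have "i \<ge> 2" using i iw by (cases "i = 1") auto
  then obtain c where c: "\<And>n. norm (1 / (of_nat n + b) ^ i) \<le> c / real (Suc n) ^ 2"
    using norm_inverse_shifted_power_le[OF b] by blast
  have "summable (\<lambda>n. c * inverse (real (Suc n) ^ 2))"
    using inverse_power_summable[of 2, where 'a = real] summable_Suc_iff[of "\<lambda>n. inverse (real n ^ 2)"]
    by (intro summable_mult) auto
  moreover have "norm (w ^ n / (of_nat n + b) ^ i) \<le> c * inverse (real (Suc n) ^ 2)" for n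
    using c[of n] True by (simp add: divide_inverse del: of_nat_Suc)
  ultimately show ?thesis
    by (rule summable_comparison_test'[where N = 0])
qed

text \<open>
  A bounded sequence with increments of order $1/n$ may be inserted without destroying
  convergence; the partial sums of the first factor of an Euler sum are of this kind.
\<close>

lemma summable_mult_power_over_shifted_power:
  fixes b w :: complex
  assumes b: "\<And>n. of_nat n + b \<noteq> 0" and i: "i \<ge> 1" and w: "norm w = 1" and iw: "(i, w) \<noteq> (1, 1)"
    and z: "\<And>n. norm (z n) \<le> c" and dz: "\<And>n. norm (z (Suc n) - z n) \<le> d / real (Suc n)"
  shows "summable (\<lambda>n. z n * (w ^ n / (of_nat n + b) ^ i))"
proof (cases "w = 1")
  case False
  obtain C where "tail_bound (\<lambda>n. (z n * (1 / (of_nat n + b) ^ i)) * w ^ n) C"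
    using decay_tail_bound[OF decay_mult[OF z dz decay_inverse_shifted_power[OF b i]] w False] by blast
  from tail_bound_summable[OF this] show ?thesis by simp
next
  case True
  then have "i \<ge> 2" using i iw by (cases "i = 1") auto
  then obtain e where e: "\<And>n. norm (1 / (of_nat n + b) ^ i) \<le> e / real (Suc n) ^ 2"
    using norm_inverse_shifted_power_le[OF b] by blast
  have c0: "0 \<le> c" using z[of 0] norm_ge_zero[of "z 0"] by linarith
  have "summable (\<lambda>n. c * (e * inverse (real (Suc n) ^ 2)))"
    using inverse_power_summable[of 2, where 'a = real] summable_Suc_iff[of "\<lambda>n. inverse (real n ^ 2)"]
    by (intro summable_mult) auto
  moreover have "norm (z n * (w ^ n / (of_nat n + b) ^ i)) \<le> c * (e * inverse (real (Suc n) ^ 2))" for n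
    unfolding norm_mult using e[of n] z[of n] c0 True
    by (intro mult_mono) (auto simp: divide_inverse simp del: of_nat_Suc)
  ultimately show ?thesis
    by (rule summable_comparison_test'[where N = 0])
qed

section \<open>Partial fractions\<close>

text \<open>Since t = Y - X, the function \<open>e\<close> below satisfies t e(P+1,Q+1) = e(P,Q+1) -
  e(P+1,Q). Both sums on the right obey the same recursion by Pascal's rule, so a double induction
  leaves only the edges P = 0 and Q = 0.\<close>

lemma partial_fractions:
  fixes X Y t :: complex
  assumes X: "X \<noteq> 0" and Y: "Y \<noteq> 0" and t: "t \<noteq> 0" and YX: "Y = X + t"
  shows "1 / (Y ^ Suc P * X ^ Suc Q)
    = (-1) ^ Suc Q * (\<Sum>i\<le>P. of_nat ((Q + i) choose Q) / (t ^ (Q + i + 1) * Y ^ (P - i + 1)))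
      + (\<Sum>i\<le>Q. (-1) ^ i * of_nat ((P + i) choose P) / (t ^ (P + i + 1) * X ^ (Q - i + 1)))"
proof -
  define s where "s P Q = (\<Sum>i\<le>P. of_nat ((Q + i) choose Q) / (t ^ (Q + i + 1) * Y ^ (P - i + 1)))" for P Q
  define f where "f P Q = (-1) ^ Suc Q * s P Q" for P Q
  define g where "g P Q = (\<Sum>i\<le>Q. (-1) ^ i * of_nat ((P + i) choose P) / (t ^ (P + i + 1) * X ^ (Q - i + 1)))" for P Q
  define e where "e P Q = 1 / (Y ^ P * X ^ Q)" for P Q
  have estep: "t * e (Suc P) (Suc Q) = e P (Suc Q) - e (Suc P) Q" for P Q
    unfolding e_def using X Y by (simp add: field_simps) (simp add: YX algebra_simps)
  have sstep: "t * s (Suc P) (Suc Q) = s P (Suc Q) + s (Suc P) Q" for P Q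
  proof -
    have "t * (\<Sum>i\<le>Suc P. of_nat ((Suc Q + i) choose Suc Q) / (t ^ (Suc Q + i + 1) * Y ^ (Suc P - i + 1)))
       = (\<Sum>i\<le>Suc P. of_nat ((Suc Q + i) choose Suc Q) / (t ^ (Q + i + 1) * Y ^ (Suc P - i + 1)))"
      unfolding sum_distrib_left using t by (intro sum.cong) auto
    \<comment> \<open>Pascal's rule. The first part vanishes at i = 0, and shifting its index yields
      \<open>s P (Suc Q)\<close>.\<close>
    also have "\<dots> = (\<Sum>i\<le>Suc P. of_nat ((Q + i) choose Suc Q) / (t ^ (Q + i + 1) * Y ^ (Suc P - i + 1)))
       + (\<Sum>i\<le>Suc P. of_nat ((Q + i) choose Q) / (t ^ (Q + i + 1) * Y ^ (Suc P - i + 1)))"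
      unfolding sum.distrib[symmetric] by (intro sum.cong) (auto simp: add_divide_distrib)
    also have "(\<Sum>i\<le>Suc P. of_nat ((Q + i) choose Suc Q) / (t ^ (Q + i + 1) * Y ^ (Suc P - i + 1)))
       = (\<Sum>i\<le>P. of_nat ((Suc Q + i) choose Suc Q) / (t ^ (Suc Q + i + 1) * Y ^ (P - i + 1)))"
      unfolding sum.atMost_Suc_shift by (simp add: mult_ac)
    finally show ?thesis unfolding s_def .
  qed
  have fstep: "t * f (Suc P) (Suc Q) = f P (Suc Q) - f (Suc P) Q" for P Q
    unfolding f_def mult.left_commute[of t] sstep by (simp add: algebra_simps)
  have gstep: "t * g (Suc P) (Suc Q) = g P (Suc Q) - g (Suc P) Q" for P Q
  proof -
    have "t * g (Suc P) (Suc Q) = (\<Sum>i\<le>Suc Q. (-1) ^ i * of_nat ((Suc P + i) choose Suc P) / (t ^ (P + i + 1) * X ^ (Suc Q - i + 1)))"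
      unfolding g_def sum_distrib_left using t by (intro sum.cong) auto
    also have "\<dots> = (\<Sum>i\<le>Suc Q. (-1) ^ i * of_nat ((P + i) choose Suc P) / (t ^ (P + i + 1) * X ^ (Suc Q - i + 1)))
       + g P (Suc Q)"
      unfolding g_def sum.distrib[symmetric] by (intro sum.cong) (auto simp: add_divide_distrib ring_distribs)
    also have "(\<Sum>i\<le>Suc Q. (-1) ^ i * of_nat ((P + i) choose Suc P) / (t ^ (P + i + 1) * X ^ (Suc Q - i + 1)))
       = - g (Suc P) Q"
      unfolding g_def sum.atMost_Suc_shift by (simp add: mult_ac sum_negf[symmetric])
    finally show ?thesis by simp
  qed
  \<comment> \<open>On each edge one of the two sums has a homogeneous recursion, while the other
    picks up the pure power of X or Y contributed by \<open>e\<close>.\<close>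
  have f0: "t * f 0 (Suc Q) = - f 0 Q" for Q
    unfolding f_def s_def using t by (simp add: field_simps)
  have g0: "t * g (Suc P) 0 = g P 0" for P
    unfolding g_def using t by (simp add: field_simps)
  have g0': "t * g 0 (Suc Q) = e 0 (Suc (Suc Q)) - g 0 Q" for Q
  proof -
    have "t * g 0 (Suc Q) = (\<Sum>i\<le>Suc Q. (-1) ^ i / (t ^ i * X ^ (Suc Q - i + 1)))"
      unfolding g_def sum_distrib_left using t by (intro sum.cong) (auto simp: field_simps)
    also have "\<dots> = e 0 (Suc (Suc Q)) - g 0 Q"
      unfolding g_def e_def sum.atMost_Suc_shift by (simp add: mult_ac sum_negf[symmetric])
    finally show ?thesis .
  qed
  have f0': "t * f (Suc P) 0 = f P 0 - e (Suc (Suc P)) 0" for P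
  proof -
    have "t * f (Suc P) 0 = - (\<Sum>i\<le>Suc P. 1 / (t ^ i * Y ^ (Suc P - i + 1)))"
      unfolding f_def s_def sum_distrib_left sum_negf[symmetric] using t by (intro sum.cong) (auto simp: field_simps)
    also have "\<dots> = f P 0 - e (Suc (Suc P)) 0"
      unfolding f_def s_def e_def sum.atMost_Suc_shift by (simp add: mult_ac)
    finally show ?thesis .
  qed
  have cancel: "u = v" if "t * u = t * v" for u v using that t by simp
  have "e (Suc P) (Suc Q) = f P Q + g P Q"
  proof (induction P arbitrary: Q)
    case 0
    show ?case
    proof (induction Q)
      case 0
      show ?case unfolding e_def f_def s_def g_def using X Y t by (simp add: field_simps) (simp add: YX)
    next
      case (Suc Q)
      show ?case
        by (rule cancel) (simp only: estep ring_distribs f0 g0' Suc.IH, simp)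
    qed
  next
    case (Suc P)
    note IH = Suc.IH
    show ?case
    proof (induction Q)
      case 0
      show ?case
        by (rule cancel) (simp only: estep ring_distribs f0' g0 IH, simp)
    next
      case (Suc Q)
      show ?case
        by (rule cancel) (simp only: estep ring_distribs fstep gstep IH Suc.IH, simp)
    qed
  qed
  then show ?thesis unfolding e_def f_def s_def g_def .
qed

section \<open>Triangular sums over integer intervals\<close>

text \<open>The map n -> -1 - n exchanges the nonnegative and the negative half of the interval; the
  half-open form makes it symmetric under this map, with no fixed point at 0.\<close>

lemma sum_symmetric_int_interval:
  fixes f :: "int \<Rightarrow> 'a :: comm_monoid_add"
  shows "(\<Sum>n\<in>{- int M..<int M}. f n) = (\<Sum>n<M. f (int n)) + (\<Sum>n<M. f (- 1 - int n))"
proof (induction M)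
  case (Suc M)
  have "{- int (Suc M)..<int (Suc M)} = insert (int M) (insert (-1 - int M) {- int M..<int M})"
    by auto
  then show ?case by (simp add: Suc.IH add_ac)
qed simp

text \<open>Quadrant by quadrant: for k, n >= 0 the condition n < k is the complement of k <= n; for
  n < 0 <= k it always holds, for k < 0 <= n never; for k, n < 0 reflection reverses the order,
  which leaves an Euler-type sum minus its diagonal.\<close>

lemma sum_int_strict_triangle:
  fixes g h :: "int \<Rightarrow> complex"
  shows "(\<Sum>k\<in>{- int M..<int M}. \<Sum>n\<in>{- int M..<int M}. if n < k then g k * h n else 0)
    = (\<Sum>k<M. g (int k)) * (\<Sum>n<M. h (int n)) - (\<Sum>n<M. (\<Sum>k\<le>n. g (int k)) * h (int n))
      + (\<Sum>k<M. g (int k)) * (\<Sum>n<M. h (- 1 - int n))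
      + (\<Sum>n<M. (\<Sum>k\<le>n. g (- 1 - int k)) * h (- 1 - int n))
      - (\<Sum>n<M. g (- 1 - int n) * h (- 1 - int n))"
proof -
  have aux: "(\<Sum>k<M. \<Sum>n<M. if n \<ge> k then u k * v n else 0) = (\<Sum>n<M. (\<Sum>k\<le>n. u k) * v n)"
    for u v :: "nat \<Rightarrow> complex"
  proof -
    have "(\<Sum>k<M. \<Sum>n<M. if n \<ge> k then u k * v n else 0)
       = (\<Sum>n<M. \<Sum>k<M. if k \<le> n then u k * v n else 0)" by (rule sum.swap)
    also have "\<dots> = (\<Sum>n<M. (\<Sum>k\<le>n. u k) * v n)"
    proof (rule sum.cong[OF refl])
      fix n assume "n \<in> {..<M}"
      then have "{k \<in> {..<M}. k \<le> n} = {..n}" by auto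
      then show "(\<Sum>k<M. if k \<le> n then u k * v n else 0) = (\<Sum>k\<le>n. u k) * v n"
        by (simp add: sum.If_cases sum_distrib_right Int_def) 
    qed
    finally show ?thesis .
  qed
  have 1: "(\<Sum>k<M. \<Sum>n<M. if n < k then u k * v n else 0)
     = (\<Sum>k<M. u k) * (\<Sum>n<M. v n) - (\<Sum>n<M. (\<Sum>k\<le>n. u k) * v n)" for u v :: "nat \<Rightarrow> complex"
    unfolding aux[symmetric] sum_product sum_subtractf[symmetric] by (intro sum.cong) auto
  have 2: "(\<Sum>k<M. \<Sum>n<M. if k < n then u k * v n else 0)
     = (\<Sum>n<M. (\<Sum>k\<le>n. u k) * v n) - (\<Sum>n<M. u n * v n)" for u v :: "nat \<Rightarrow> complex"
  proof -
    have "(\<Sum>n<M. u n * v n) = (\<Sum>k<M. \<Sum>n<M. if n = k then u k * v n else 0)"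
      by simp
    then show ?thesis
      unfolding aux[symmetric] by (simp only: sum_subtractf[symmetric]) (intro sum.cong, auto)
  qed
  have 3: "(\<Sum>k<M. \<Sum>n<M. u k * v n) = (\<Sum>k<M. u k) * (\<Sum>n<M. v n)" for u v :: "nat \<Rightarrow> complex"
    by (simp only: sum_product)
  have 4: "- 1 - int n < int k" "\<not> int n < - 1 - int k" "- 1 - int n < - 1 - int k \<longleftrightarrow> k < n" for k n
    by auto
  show ?thesis
    unfolding sum_symmetric_int_interval by (simp add: 4 sum.distrib 1 2 3)
qed

text \<open>With j = k - n fixed, k < M becomes n < M - j, and k >= -M follows from n >= -M.\<close>

lemma sum_int_strict_triangle_by_difference:
  fixes F :: "int \<Rightarrow> int \<Rightarrow> complex"
  shows "(\<Sum>k\<in>{- int M..<int M}. \<Sum>n\<in>{- int M..<int M}. if n < k then F k n else 0)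
    = (\<Sum>j=1..<2*M. \<Sum>n\<in>{- int M..<int M - int j}. F (n + int j) n)"
proof -
  let ?I = "{- int M..<int M}"
  have "(\<Sum>k\<in>?I. \<Sum>n\<in>?I. if n < k then F k n else 0)
      = (\<Sum>z\<in>?I \<times> ?I. if snd z < fst z then F (fst z) (snd z) else 0)"
    by (simp add: sum.cartesian_product case_prod_beta)
  also have "\<dots> = (\<Sum>z\<in>{z \<in> ?I \<times> ?I. snd z < fst z}. F (fst z) (snd z))"
    by (rule sum.inter_filter[symmetric]) auto
  also have "\<dots> = (\<Sum>z\<in>(SIGMA j:{1..<2*M}. {- int M..<int M - int j}). F (snd z + int (fst z)) (snd z))"
    by (rule sum.reindex_bij_witness[of _ "\<lambda>z. (snd z + int (fst z), snd z)" "\<lambda>z. (nat (fst z - snd z), snd z)"])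
       auto
  also have "\<dots> = (\<Sum>j=1..<2*M. \<Sum>n\<in>{- int M..<int M - int j}. F (n + int j) n)"
    by (subst sum.Sigma) (auto simp: case_prod_beta)
  finally show ?thesis .
qed

text \<open>Each term is (1/j + 1/(M+1-j))/(M+1), and both halves sum to the harmonic number. This
  is the total weighted error of the windows with j <= M.\<close>

lemma sum_inverse_mult_reflect:
  "(\<Sum>j=1..M. 1 / (real j * real (Suc M - j))) = 2 * harm M / real (Suc M)"
proof -
  have "(\<Sum>j=1..M. 1 / (real j * real (Suc M - j)))
      = (\<Sum>j=1..M. (inverse (real j) + inverse (real (Suc M - j))) / real (Suc M))"
  proof (intro sum.cong refl)
    fix j assume "j \<in> {1..M}"
    then have "real (Suc M) = real j + real (Suc M - j)" "real j > 0" "real (Suc M - j) > 0" by auto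
    then show "1 / (real j * real (Suc M - j)) = (inverse (real j) + inverse (real (Suc M - j))) / real (Suc M)"
      by (simp only:) (simp add: divide_simps)
  qed
  also have "\<dots> = ((\<Sum>j=1..M. inverse (real j)) + (\<Sum>j=1..M. inverse (real (Suc M - j)))) / real (Suc M)"
    by (simp only: sum_divide_distrib[symmetric] sum.distrib)
  also have "(\<Sum>j=1..M. inverse (real (Suc M - j))) = (\<Sum>j=1..M. inverse (real j))"
    by (rule sum.reindex_bij_witness[of _ "\<lambda>j. Suc M - j" "\<lambda>j. Suc M - j"]) auto
  finally show ?thesis by (simp add: harm_def)
qed

text \<open>The difference of the harmonic number and ln M has a finite limit, and ln M / M tends to
  0.\<close>

lemma harm_over_Suc_tendsto_0: "(\<lambda>M. harm M / real (Suc M) :: real) \<longlonglongrightarrow> 0"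
proof (rule tendsto_sandwich)
  show "\<forall>\<^sub>F M in sequentially. 0 \<le> harm M / real (Suc M)"
    by (simp add: harm_nonneg)
  show "\<forall>\<^sub>F M in sequentially. harm M / real (Suc M) \<le> (harm M - ln (real M)) * (1 / real M) + ln (real M) / real M"
    using eventually_gt_at_top[of 0]
  proof eventually_elim
    case (elim M)
    have "harm M / real (Suc M) \<le> harm M / real M"
      using elim by (intro divide_left_mono) (auto simp: harm_nonneg)
    then show ?case by (simp add: diff_divide_distrib)
  qed
  show "(\<lambda>M. (harm M - ln (real M)) * (1 / real M) + ln (real M) / real M) \<longlonglongrightarrow> 0"
    using tendsto_add[OF tendsto_mult[OF euler_mascheroni_LIMSEQ lim_1_over_n] lim_ln_over_n] by simp
qed simp

lemma int_interval_sum_pos: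
  fixes f :: "int \<Rightarrow> 'a :: comm_monoid_add"
  assumes "j \<le> M"
  shows "(\<Sum>n\<in>{- int M..<int M - int j}. f n) = (\<Sum>n<M. f (- 1 - int n)) + (\<Sum>n<M - j. f (int n))"
proof -
  have "{- int M..<int M - int j} = {- int M..<0} \<union> {0..<int (M - j)}" using assms by auto
  then have "(\<Sum>n\<in>{- int M..<int M - int j}. f n)
      = (\<Sum>n\<in>{- int M..<0}. f n) + (\<Sum>n\<in>{0..<int (M - j)}. f n)"
    by (simp add: sum.union_disjoint)
  also have "(\<Sum>n\<in>{- int M..<0}. f n) = (\<Sum>n<M. f (- 1 - int n))"
    by (rule sum.reindex_bij_witness[of _ "\<lambda>n. - 1 - int n" "\<lambda>n. nat (- 1 - n)"]) auto
  also have "(\<Sum>n\<in>{0..<int (M - j)}. f n) = (\<Sum>n<M - j. f (int n))"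
    by (rule sum.reindex_bij_witness[of _ int nat]) auto
  finally show ?thesis .
qed

text \<open>For j >= M the window lies among the negative integers; reflected, it is a block
  starting at j - M, to which \<open>tail_bound\<close> applies.\<close>

lemma int_interval_sum_neg:
  fixes f :: "int \<Rightarrow> 'a :: comm_monoid_add"
  assumes "M \<le> j"
  shows "(\<Sum>n\<in>{- int M..<int M - int j}. f n) = (\<Sum>n=j - M..<M. f (- 1 - int n))"
  by (rule sum.reindex_bij_witness[of _ "\<lambda>n. - 1 - int n" "\<lambda>n. nat (- 1 - n)"]) (use assms in auto)

text \<open>The window is invariant under n -> -1 - n - j. Thus the partial fractions in powers of n
  + j + a come under the same limit lemma as those in powers of n + a.\<close>

lemma int_interval_sum_reflect:
  fixes f :: "int \<Rightarrow> 'a :: comm_monoid_add"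
  shows "(\<Sum>n\<in>{- int M..<int M - int j}. f (n + int j)) = (\<Sum>n\<in>{- int M..<int M - int j}. f (- 1 - n))"
  by (rule sum.reindex_bij_witness[of _ "\<lambda>n. - 1 - n - int j" "\<lambda>n. - 1 - n - int j"]) auto

text \<open>
  The inner sum is within $O(1/(M-j+1))$ of its limit for $j \<le> M$ and is itself
  $O(1/(j-M+1))$ for $j > M$; weighted by $1/j$, the errors add up to $O(H_M / M)$.
\<close>

lemma weighted_window_sums_tendsto:
  fixes f :: "int \<Rightarrow> complex" and g :: "nat \<Rightarrow> complex"
  assumes tp: "tail_bound (\<lambda>n. f (int n)) C" and tm: "tail_bound (\<lambda>n. f (- 1 - int n)) C'"
    and sp: "(\<lambda>n. f (int n)) sums Bp" and sm: "(\<lambda>n. f (- 1 - int n)) sums Bm"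
    and g: "\<And>j. j \<ge> 1 \<Longrightarrow> norm (g j) \<le> 1 / real j" and G: "(\<lambda>j. g (Suc j)) sums G"
  shows "(\<lambda>M. \<Sum>j=1..<2*M. g j * (\<Sum>n\<in>{- int M..<int M - int j}. f n)) \<longlonglongrightarrow> G * (Bp + Bm)"
proof -
  define U where "U M j = (\<Sum>n\<in>{- int M..<int M - int j}. f n)" for M j
  define D where "D = max C C'"
  have DC: "C / real (Suc k) \<le> D / real (Suc k)" "C' / real (Suc k) \<le> D / real (Suc k)" for k
    unfolding D_def by (intro divide_right_mono; simp)+
  have D0: "0 \<le> D"
    using tp[unfolded tail_bound_def, rule_format, of 0 0] unfolding D_def by simp
  have small: "norm (U M j - (Bp + Bm)) \<le> 2 * D / real (Suc M - j)" if "j \<le> M" for M j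
  proof -
    have "U M j - (Bp + Bm) = ((\<Sum>n<M - j. f (int n)) - Bp) + ((\<Sum>n<M. f (- 1 - int n)) - Bm)"
      unfolding U_def int_interval_sum_pos[OF that] by simp
    also have "norm \<dots> \<le> D / real (Suc (M - j)) + D / real (Suc M)"
      using tail_bound_error[OF tp sp, of "M - j"] tail_bound_error[OF tm sm, of M] DC[of "M - j"] DC[of M]
      by (intro order_trans[OF norm_triangle_ineq] add_mono) (auto simp del: of_nat_Suc)
    also have "D / real (Suc M) \<le> D / real (Suc (M - j))"
      using D0 by (intro divide_left_mono) auto
    finally show ?thesis using that by (simp add: Suc_diff_le)
  qed
  have big: "norm (U M j) \<le> D / real (Suc (j - M))" if "M \<le> j" "j < 2 * M" for M j
  proof -
    have "norm (U M j) \<le> C' / real (Suc (j - M))"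
      unfolding U_def int_interval_sum_neg[OF that(1)]
      by (intro tm[unfolded tail_bound_def, rule_format]) (use that in auto)
    then show ?thesis using DC(2)[of "j - M"] by linarith
  qed
  \<comment> \<open>The constant 5D is 4D from j <= M plus D from j > M. The comparison sum stops at
    M because later windows are small instead of close to Bp + Bm.\<close>
  have err: "norm ((\<Sum>j=1..<2*M. g j * U M j) - (\<Sum>j=1..M. g j) * (Bp + Bm)) \<le> 5 * D * (harm M / real (Suc M))"
    if M: "M \<ge> 1" for M
  proof -
    have "{1..<2*M} = {1..M} \<union> {Suc M..<2*M}" using M by auto
    then have "(\<Sum>j=1..<2*M. g j * U M j) = (\<Sum>j=1..M. g j * U M j) + (\<Sum>j=Suc M..<2*M. g j * U M j)"
      by (simp only:) (rule sum.union_disjoint, auto)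
    then have "(\<Sum>j=1..<2*M. g j * U M j) - (\<Sum>j=1..M. g j) * (Bp + Bm)
        = (\<Sum>j=1..M. g j * (U M j - (Bp + Bm))) + (\<Sum>j=Suc M..<2*M. g j * U M j)"
      by (simp add: sum_distrib_right right_diff_distrib sum_subtractf)
    then have split: "norm ((\<Sum>j=1..<2*M. g j * U M j) - (\<Sum>j=1..M. g j) * (Bp + Bm))
        \<le> norm (\<Sum>j=1..M. g j * (U M j - (Bp + Bm))) + norm (\<Sum>j=Suc M..<2*M. g j * U M j)"
      by (simp only: norm_triangle_ineq)
    have "norm (\<Sum>j=1..M. g j * (U M j - (Bp + Bm))) \<le> (\<Sum>j=1..M. 2 * D * (1 / (real j * real (Suc M - j))))"
    proof (rule sum_norm_le)
      fix j assume j: "j \<in> {1..M}"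
      have "norm (g j * (U M j - (Bp + Bm))) \<le> 1 / real j * (2 * D / real (Suc M - j))"
        unfolding norm_mult using j by (intro mult_mono g small) auto
      moreover have "1 / r * (2 * D / s) = 2 * D * (1 / (r * s))" for r s by simp
      ultimately show "norm (g j * (U M j - (Bp + Bm))) \<le> 2 * D * (1 / (real j * real (Suc M - j)))"
        by (simp only:)
    qed
    also have "\<dots> = 4 * D * (harm M / real (Suc M))"
      unfolding sum_distrib_left[symmetric] sum_inverse_mult_reflect by simp
    finally have head: "norm (\<Sum>j=1..M. g j * (U M j - (Bp + Bm))) \<le> 4 * D * (harm M / real (Suc M))" .
    \<comment> \<open>Here 1/j <= 1/(M+1), and the block bounds D/(j - M) sum to at most D times the
      harmonic number.\<close>
    have "norm (\<Sum>j=Suc M..<2*M. g j * U M j) \<le> (\<Sum>j=Suc M..<2*M. D / real (Suc M) * inverse (real (j - M)))"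
    proof (rule sum_norm_le)
      fix j assume j: "j \<in> {Suc M..<2*M}"
      have "norm (g j * U M j) \<le> 1 / real (Suc M) * (D / real (j - M))"
        unfolding norm_mult
      proof (intro mult_mono)
        have "1 / real j \<le> 1 / real (Suc M)" using j by (intro divide_left_mono) auto
        then show "norm (g j) \<le> 1 / real (Suc M)" using g[of j] j by auto
        have "D / real (Suc (j - M)) \<le> D / real (j - M)" using j D0 by (intro divide_left_mono) auto
        then show "norm (U M j) \<le> D / real (j - M)" using big[of M j] j by auto
      qed auto
      then show "norm (g j * U M j) \<le> D / real (Suc M) * inverse (real (j - M))"
        by (simp add: divide_inverse mult_ac del: of_nat_Suc)
    qed
    also have "\<dots> = D / real (Suc M) * (\<Sum>j=1..<M. inverse (real j))"
      unfolding sum_distrib_left[symmetric]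
      by (intro arg_cong2[where f = "(*)"] refl
            sum.reindex_bij_witness[of _ "\<lambda>j. j + M" "\<lambda>j. j - M"]) auto
    also have "\<dots> \<le> D / real (Suc M) * harm M"
      unfolding harm_def using D0 by (intro mult_left_mono sum_mono2) auto
    finally have "norm (\<Sum>j=Suc M..<2*M. g j * U M j) \<le> D * (harm M / real (Suc M))" by simp
    then show ?thesis using split head by linarith
  qed
  have bound_0: "(\<lambda>M. 5 * D * (harm M / real (Suc M))) \<longlonglongrightarrow> 0"
    using tendsto_mult_left[OF harm_over_Suc_tendsto_0, of "5 * D"] by simp
  have "\<forall>\<^sub>F M in sequentially. norm ((\<Sum>j=1..<2*M. g j * U M j) - (\<Sum>j=1..M. g j) * (Bp + Bm))
      \<le> 5 * D * (harm M / real (Suc M))"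
    using err by (rule eventually_sequentiallyI)
  from Lim_null_comparison[OF this bound_0] have "(\<lambda>M. (\<Sum>j=1..<2*M. g j * U M j) - (\<Sum>j=1..M. g j) * (Bp + Bm)) \<longlonglongrightarrow> 0" .
  moreover have "(\<lambda>M. (\<Sum>j=1..M. g j) * (Bp + Bm)) \<longlonglongrightarrow> G * (Bp + Bm)"
  proof -
    have "(\<Sum>j=1..M. g j) = (\<Sum>j<M. g (Suc j))" for M
      by (rule sum.reindex_bij_witness[of _ Suc "\<lambda>j. j - 1"]) auto
    then show ?thesis using G unfolding sums_def by (intro tendsto_intros) simp
  qed
  ultimately have "(\<lambda>M. ((\<Sum>j=1..<2*M. g j * U M j) - (\<Sum>j=1..M. g j) * (Bp + Bm))
      + (\<Sum>j=1..M. g j) * (Bp + Bm)) \<longlonglongrightarrow> 0 + G * (Bp + Bm)"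
    by (rule tendsto_add)
  then show ?thesis by (simp add: U_def)
qed

section \<open>Polylogarithms and Euler sums\<close>

lemma tail_bound_cmult:
  assumes "tail_bound f C"
  shows "tail_bound (\<lambda>n. c * f n) (norm c * C)"
  using assms unfolding tail_bound_def
  by (auto simp: sum_distrib_left[symmetric] norm_mult mult_left_mono
      simp flip: times_divide_eq_right simp del: of_nat_Suc)

text \<open>With N = -1 - n one has N + a = -(n + (1 - a)) and w^N = (1/w)^(n+1). This is the source
  of the parameter 1 - a, the inverted arguments and the signs.\<close>

lemma reflected_power_quotient:
  fixes w a :: complex
  shows "w powi (- 1 - int n) / (of_int (- 1 - int n) + a) ^ i
    = (- 1) ^ i * (inverse w ^ Suc n / (of_nat n + (1 - a)) ^ i)"
proof -
  have "w powi (- 1 - int n) = w powi (- int (Suc n))" by simp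
  also have "\<dots> = inverse w ^ Suc n" by (simp only: power_int_minus power_int_of_nat power_inverse)
  finally have 1: "w powi (- 1 - int n) = inverse w ^ Suc n" .
  have "of_int (- 1 - int n) + a = - (of_nat n + (1 - a))" by simp
  then have "(of_int (- 1 - int n) + a) ^ i = (- 1) ^ i * (of_nat n + (1 - a)) ^ i"
    by (simp only: power_minus[of "of_nat n + (1 - a)"])
  moreover have "W / ((- 1) ^ i * Z) = (- 1) ^ i * (W / Z)" for W Z :: complex
    by (cases "even i") simp_all
  ultimately show ?thesis by (simp only: 1)
qed

lemma Li_Hurwitz_sums:
  fixes b w :: complex
  assumes b: "\<And>n. of_nat n + b \<noteq> 0" and i: "i \<ge> 1" and w: "norm w = 1" and iw: "(i, w) \<noteq> (1, 1)"
  shows "(\<lambda>n. w ^ Suc n / (of_nat n + b) ^ i) sums Li_Hurwitz i w b"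
proof -
  have "summable (\<lambda>n. w * (w ^ n / (of_nat n + b) ^ i))"
    by (intro summable_mult summable_power_over_shifted_power[OF b i w iw])
  then have "summable (\<lambda>n. w ^ Suc n / (of_nat n + b) ^ i)" by simp
  moreover have "Li_Hurwitz i w b = (\<Sum>n. w ^ Suc n / (of_nat n + b) ^ i)"
    unfolding Li_Hurwitz_def by (simp add: add_ac)
  ultimately show ?thesis by (simp add: summable_sums)
qed

lemma Li_sums:
  assumes "i \<ge> 1" and "norm w = 1" and "(i, w) \<noteq> (1, 1)"
  shows "(\<lambda>n. w ^ Suc n / of_nat (Suc n) ^ i) sums Li i w"
proof -
  have "(\<lambda>n. w ^ Suc n / (of_nat n + 1) ^ i) sums Li_Hurwitz i w 1"
    by (intro Li_Hurwitz_sums assms) (metis of_nat_Suc of_nat_neq_0 add.commute)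
  then show ?thesis by (simp add: Li_def Li_Hurwitz_def add.commute)
qed

text \<open>The two indexing conventions meet here: an Euler sum with parameter c - 1 has the same
  denominators n + c, n >= 0, as \<open>Li_Hurwitz\<close> with parameter c.\<close>

lemma zeta_partial_Suc_eq:
  "zeta_partial (Suc n) p u (c - 1) = (\<Sum>k\<le>n. u ^ Suc k / (of_nat k + c) ^ p)"
  unfolding zeta_partial_def
  by (rule sum.reindex_bij_witness[of _ Suc "\<lambda>k. k - 1"]) (auto simp: of_nat_diff algebra_simps)

text \<open>As (p, u) \<noteq> (1, 1), the inner partial sums converge and so are bounded; their
  increments are single terms of order 1/n. Hence they may be inserted as the factor
  \<open>z\<close>.\<close>

lemma euler_S_sums:
  fixes c u v :: complex
  assumes c: "\<And>n. of_nat n + c \<noteq> 0" and p: "p \<ge> 1" and q: "q \<ge> 1"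
    and u: "norm u = 1" and v: "norm v = 1" and pu: "(p, u) \<noteq> (1, 1)" and qv: "(q, v) \<noteq> (1, 1)"
  shows "(\<lambda>n. (\<Sum>k\<le>n. u ^ Suc k / (of_nat k + c) ^ p) * (v ^ Suc n / (of_nat n + c) ^ q))
    sums euler_S (c - 1) p q u v"
proof -
  define z where "z n = (\<Sum>k\<le>n. u ^ Suc k / (of_nat k + c) ^ p)" for n
  have "z \<longlonglongrightarrow> Li_Hurwitz p u c"
    using Li_Hurwitz_sums[OF c p u pu] unfolding z_def by (simp add: sums_def_le)
  then have "Bseq z" using convergentI convergent_imp_Bseq by blast
  then obtain K where K: "\<And>n. norm (z n) \<le> K" unfolding Bseq_def by blast
  obtain d where d: "\<And>n. norm (1 / (of_nat n + c) ^ p) \<le> d / real (Suc n)"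
    using decay_inverse_shifted_power[OF c p] unfolding decay_def by blast
  have d0: "0 \<le> d" using order_trans[OF norm_ge_zero d[of 0]] by simp
  have dz: "norm (z (Suc n) - z n) \<le> d / real (Suc n)" for n
  proof -
    have "norm (z (Suc n) - z n) = norm (1 / (of_nat (Suc n) + c) ^ p)"
      by (simp add: z_def norm_mult norm_divide norm_power u)
    also have "\<dots> \<le> d / real (Suc (Suc n))" by (rule d)
    also have "\<dots> \<le> d / real (Suc n)" using d0 by (intro divide_left_mono) auto
    finally show ?thesis .
  qed
  have "summable (\<lambda>n. v * (z n * (v ^ n / (of_nat n + c) ^ q)))"
    by (intro summable_mult summable_mult_power_over_shifted_power[OF c q v qv K dz])
  moreover have "v * (z n * (v ^ n / (of_nat n + c) ^ q)) = z n * (v ^ Suc n / (of_nat n + c) ^ q)" for n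
    by simp
  ultimately have "summable (\<lambda>n. z n * (v ^ Suc n / (of_nat n + c) ^ q))" by (simp only:)
  moreover have "euler_S (c - 1) p q u v = (\<Sum>n. z n * (v ^ Suc n / (of_nat n + c) ^ q))"
    unfolding euler_S_def zeta_partial_Suc_eq z_def by (simp add: add_ac)
  ultimately show ?thesis by (simp add: summable_sums z_def)
qed

text \<open>Partial fractions with t = j. The numerator y^(n+j) (xy)^(-n) is written y^j x^(-n) over
  powers of n + a, but (xy)^j x^(-(n+j)) over powers of n + j + a, so that each inner sum depends on
  one index only.\<close>

lemma window_convolution:
  fixes x y a :: complex
  assumes a: "\<And>k::int. of_int k + a \<noteq> 0" and x: "x \<noteq> 0" and y: "y \<noteq> 0" and j: "j \<ge> 1"
  shows "(\<Sum>n\<in>I. y powi (n + int j) / (of_int (n + int j) + a) ^ Suc P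
            * (inverse (x * y) powi n / (of_int n + a) ^ Suc Q))
    = (\<Sum>i\<le>P. (-1) ^ Suc Q * of_nat ((Q + i) choose Q) * ((x * y) ^ j / of_nat j ^ (Q + i + 1)
          * (\<Sum>n\<in>I. inverse x powi (n + int j) / (of_int (n + int j) + a) ^ (P - i + 1))))
      + (\<Sum>i\<le>Q. (-1) ^ i * of_nat ((P + i) choose P) * (y ^ j / of_nat j ^ (P + i + 1)
          * (\<Sum>n\<in>I. inverse x powi n / (of_int n + a) ^ (Q - i + 1))))"
proof -
  have "y powi (n + int j) / (of_int (n + int j) + a) ^ Suc P
            * (inverse (x * y) powi n / (of_int n + a) ^ Suc Q)
    = (\<Sum>i\<le>P. (-1) ^ Suc Q * of_nat ((Q + i) choose Q) * ((x * y) ^ j / of_nat j ^ (Q + i + 1)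
          * (inverse x powi (n + int j) / (of_int (n + int j) + a) ^ (P - i + 1))))
      + (\<Sum>i\<le>Q. (-1) ^ i * of_nat ((P + i) choose P) * (y ^ j / of_nat j ^ (P + i + 1)
          * (inverse x powi n / (of_int n + a) ^ (Q - i + 1))))" (is "?L = ?R") for n
  proof -
    define X Y where "X = of_int n + a" and "Y = of_int (n + int j) + a"
    have pf: "1 / (Y ^ Suc P * X ^ Suc Q)
      = (-1) ^ Suc Q * (\<Sum>i\<le>P. of_nat ((Q + i) choose Q) / (of_nat j ^ (Q + i + 1) * Y ^ (P - i + 1)))
      + (\<Sum>i\<le>Q. (-1) ^ i * of_nat ((P + i) choose P) / (of_nat j ^ (P + i + 1) * X ^ (Q - i + 1)))"
    proof (rule partial_fractions)
      show "X \<noteq> 0" "Y \<noteq> 0" unfolding X_def Y_def by (rule a)+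
      show "of_nat j \<noteq> (0 :: complex)" "Y = X + of_nat j" using j by (simp_all add: X_def Y_def)
    qed
    have 1: "y powi (n + int j) * inverse (x * y) powi n = y ^ j * inverse x powi n"
      using x y by (simp add: power_int_add power_int_mult_distrib power_int_inverse field_simps)
    have 2: "y ^ j * inverse x powi n = (x * y) ^ j * inverse x powi (n + int j)"
      using x y by (simp add: power_int_add power_mult_distrib power_int_inverse field_simps)
    have "?L = (y ^ j * inverse x powi n) * (1 / (Y ^ Suc P * X ^ Suc Q))"
      unfolding X_def[symmetric] Y_def[symmetric] 1[symmetric] by simp
    also have "\<dots> = (\<Sum>i\<le>P. (-1) ^ Suc Q * of_nat ((Q + i) choose Q) * ((y ^ j * inverse x powi n)
           / (of_nat j ^ (Q + i + 1) * Y ^ (P - i + 1))))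
      + (\<Sum>i\<le>Q. (-1) ^ i * of_nat ((P + i) choose P) * ((y ^ j * inverse x powi n)
           / (of_nat j ^ (P + i + 1) * X ^ (Q - i + 1))))"
      unfolding pf distrib_left sum_distrib_left
      by (intro arg_cong2[where f = "(+)"] sum.cong refl) (simp_all only: times_divide_eq_right mult_ac)
    also have "\<dots> = ?R"
      unfolding X_def[symmetric] Y_def[symmetric]
      \<comment> \<open>Only the first sum, the one over powers of \<open>Y\<close>, changes its
        numerator.\<close>
      by (subst (1) 2) (simp only: times_divide_times_eq)
    finally show ?thesis .
  qed
  then have "(\<Sum>n\<in>I. y powi (n + int j) / (of_int (n + int j) + a) ^ Suc P
            * (inverse (x * y) powi n / (of_int n + a) ^ Suc Q))
    = (\<Sum>n\<in>I. \<Sum>i\<le>P. (-1) ^ Suc Q * of_nat ((Q + i) choose Q) * ((x * y) ^ j / of_nat j ^ (Q + i + 1)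
          * (inverse x powi (n + int j) / (of_int (n + int j) + a) ^ (P - i + 1))))
      + (\<Sum>n\<in>I. \<Sum>i\<le>Q. (-1) ^ i * of_nat ((P + i) choose P) * (y ^ j / of_nat j ^ (P + i + 1)
          * (inverse x powi n / (of_int n + a) ^ (Q - i + 1))))"
    by (simp only: sum.distrib)
  also have "\<dots> = (\<Sum>i\<le>P. \<Sum>n\<in>I. (-1) ^ Suc Q * of_nat ((Q + i) choose Q) * ((x * y) ^ j / of_nat j ^ (Q + i + 1)
          * (inverse x powi (n + int j) / (of_int (n + int j) + a) ^ (P - i + 1))))
      + (\<Sum>i\<le>Q. \<Sum>n\<in>I. (-1) ^ i * of_nat ((P + i) choose P) * (y ^ j / of_nat j ^ (P + i + 1)
          * (inverse x powi n / (of_int n + a) ^ (Q - i + 1))))"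
    by (intro arg_cong2[where f = "(+)"] sum.swap)
  finally show ?thesis by (simp only: sum_distrib_left)
qed

theorem theorem3p1:
  fixes x y a :: complex and p q :: nat
  assumes "is_root_of_unity x" and "is_root_of_unity y" and "x \<noteq> 1"
    and "a \<notin> \<int>"
    and "p \<ge> 1" and "q \<ge> 1"
    and "(p, y) \<noteq> (1, 1)" and "(q, x * y) \<noteq> (1, 1)"
  shows
    "x * euler_S (a - 1) p q y (inverse (x * y))
       - (-1) ^ (p + q) * euler_S (- a) p q (inverse y) (x * y)
     = x * Li_Hurwitz p y a * Li_Hurwitz q (inverse (x * y)) a
       + (-1) ^ q * inverse y * Li_Hurwitz p y a * Li_Hurwitz q (x * y) (1 - a)
       + (-1) ^ (p + q - 1) * Li_Hurwitz (p + q) x (1 - a)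
       + (-1) ^ q * (\<Sum>m=0..p-1. of_nat ((p + q - m - 2) choose (q - 1))
            * ((-1) ^ m * Li_Hurwitz (m + 1) x (1 - a) - x * Li_Hurwitz (m + 1) (inverse x) a)
            * Li (p + q - m - 1) (x * y))
       + (-1) ^ q * (\<Sum>m=0..q-1. of_nat ((p + q - m - 2) choose (p - 1))
            * ((-1) ^ m * x * Li_Hurwitz (m + 1) (inverse x) a - Li_Hurwitz (m + 1) x (1 - a))
            * Li (p + q - m - 1) y)"
proof -
  have norm_root: "norm z = 1" if "is_root_of_unity z" for z
    using that unfolding is_root_of_unity_def
    by (metis norm_ge_zero norm_one norm_power not_gr_zero power_eq_1_iff)
  have nx: "norm x = 1" and ny: "norm y = 1" using assms(1,2) norm_root by auto
  have nxy: "norm (x * y) = 1" using nx ny by (simp add: norm_mult)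
  have ni: "norm (inverse x) = 1" "norm (inverse y) = 1" "norm (inverse (x * y)) = 1"
    using nx ny by (simp_all add: norm_inverse norm_mult)
  have x0: "x \<noteq> 0" and y0: "y \<noteq> 0" using nx ny by auto
  have inverse_params: "(p, inverse y) \<noteq> (1, 1)" "(q, inverse (x * y)) \<noteq> (1, 1)"
    using assms(7,8) by (auto simp del: inverse_mult_distrib)
  obtain P where p: "p = Suc P" using assms(5) by (cases p) auto
  obtain Q where q: "q = Suc Q" using assms(6) by (cases q) auto
  have a_int: "of_int k + a \<noteq> 0" for k
    using assms(4) by (metis Ints_minus Ints_of_int add_eq_0_iff)
  have a_nat: "of_nat n + a \<noteq> 0" for n using a_int[of "int n"] by simp
  have a_nat': "of_nat n + (1 - a) \<noteq> 0" for n using a_int[of "- 1 - int n"]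
    by (auto simp: algebra_simps eq_neg_iff_add_eq_0)

  \<comment> \<open>Factors of F, bilateral summands and the triangle\<close>
  define g where "g k = y powi k / (of_int k + a) ^ p" for k
  define h where "h n = inverse (x * y) powi n / (of_int n + a) ^ q" for n
  define f where "f i n = inverse x powi n / (of_int n + a) ^ i" for i n
  \<comment> \<open>This is the bilateral sum of \<open>f i\<close>: the first term comes from n >=
    0, the second from n < 0 by reflection.\<close>
  define B where "B i = x * Li_Hurwitz i (inverse x) a + (- 1) ^ i * Li_Hurwitz i x (1 - a)" for i
  define T where "T M = (\<Sum>k\<in>{- int M..<int M}. \<Sum>n\<in>{- int M..<int M}. if n < k then g k * h n else 0)"
    for M

  \<comment> \<open>Hurwitz summands pair the power k + 1 with the denominator k + a, so each
    nonnegative half carries a compensating factor: 1/y for \<open>g\<close>, xy for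
    \<open>h\<close>, x for \<open>f\<close>. The product of the first two is the coefficient x of
    the theorem.\<close>
  have g_pos: "g (int k) = inverse y * (y ^ Suc k / (of_nat k + a) ^ p)" for k
    using y0 by (simp add: g_def)
  have g_neg: "g (- 1 - int k) = (- 1) ^ p * (inverse y ^ Suc k / (of_nat k + (1 - a)) ^ p)" for k
    unfolding g_def by (rule reflected_power_quotient)
  have h_pos: "h (int k) = (x * y) * (inverse (x * y) ^ Suc k / (of_nat k + a) ^ q)" for k
  proof -
    have "(x * y) * inverse (x * y) = 1" using x0 y0 by (intro right_inverse) simp
    then show ?thesis unfolding h_def power_Suc
      by (simp only: power_int_of_nat of_int_of_nat_eq times_divide_eq_right mult.assoc[symmetric] mult_1_left)
  qed
  have h_neg: "h (- 1 - int k) = (- 1) ^ q * ((x * y) ^ Suc k / (of_nat k + (1 - a)) ^ q)" for k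
    unfolding h_def reflected_power_quotient by simp
  have f_pos: "f i (int k) = x * (inverse x ^ Suc k / (of_nat k + a) ^ i)" for i k
    using x0 by (simp add: f_def)
  have f_neg: "f i (- 1 - int k) = (- 1) ^ i * (x ^ Suc k / (of_nat k + (1 - a)) ^ i)" for i k
    unfolding f_def reflected_power_quotient by simp

  \<comment> \<open>First evaluation of the triangle: quadrants\<close>
  have g_pos_sums: "(\<lambda>k. g (int k)) sums (inverse y * Li_Hurwitz p y a)"
    unfolding g_pos by (intro sums_mult Li_Hurwitz_sums a_nat assms ny)
  have h_pos_sums: "(\<lambda>k. h (int k)) sums ((x * y) * Li_Hurwitz q (inverse (x * y)) a)"
    unfolding h_pos by (intro sums_mult Li_Hurwitz_sums a_nat assms ni inverse_params)
  have h_neg_sums: "(\<lambda>k. h (- 1 - int k)) sums ((- 1) ^ q * Li_Hurwitz q (x * y) (1 - a))"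
    unfolding h_neg by (intro sums_mult Li_Hurwitz_sums a_nat' nxy assms)
  have f_pos_sums: "(\<lambda>k. f i (int k)) sums (x * Li_Hurwitz i (inverse x) a)" if "i \<ge> 1" for i
    unfolding f_pos using that assms(3) by (intro sums_mult Li_Hurwitz_sums a_nat ni) auto
  have f_neg_sums: "(\<lambda>k. f i (- 1 - int k)) sums ((- 1) ^ i * Li_Hurwitz i x (1 - a))" if "i \<ge> 1" for i
    unfolding f_neg using that assms(3) by (intro sums_mult Li_Hurwitz_sums a_nat' nx) auto

  have "(\<lambda>n. x * ((\<Sum>k\<le>n. y ^ Suc k / (of_nat k + a) ^ p) * (inverse (x * y) ^ Suc n / (of_nat n + a) ^ q)))
      sums (x * euler_S (a - 1) p q y (inverse (x * y)))"
    by (intro sums_mult euler_S_sums a_nat assms ny ni inverse_params)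
  moreover have "x * ((\<Sum>k\<le>n. y ^ Suc k / (of_nat k + a) ^ p) * (inverse (x * y) ^ Suc n / (of_nat n + a) ^ q))
      = (\<Sum>k\<le>n. g (int k)) * h (int n)" for n
    unfolding g_pos h_pos sum_distrib_left[symmetric] using x0 y0 by simp
  ultimately have S_pos: "(\<lambda>n. (\<Sum>k\<le>n. g (int k)) * h (int n))
      sums (x * euler_S (a - 1) p q y (inverse (x * y)))" by (simp only:)

  have "(\<lambda>n. (- 1) ^ (p + q) * ((\<Sum>k\<le>n. inverse y ^ Suc k / (of_nat k + (1 - a)) ^ p)
          * ((x * y) ^ Suc n / (of_nat n + (1 - a)) ^ q)))
      sums ((- 1) ^ (p + q) * euler_S (1 - a - 1) p q (inverse y) (x * y))"
    by (intro sums_mult euler_S_sums a_nat' assms nxy ni inverse_params)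
  moreover have "(- 1) ^ (p + q) * ((\<Sum>k\<le>n. inverse y ^ Suc k / (of_nat k + (1 - a)) ^ p)
          * ((x * y) ^ Suc n / (of_nat n + (1 - a)) ^ q))
      = (\<Sum>k\<le>n. g (- 1 - int k)) * h (- 1 - int n)" for n
    unfolding g_neg h_neg sum_distrib_left[symmetric] by (simp only: power_add mult_ac)
  ultimately have S_neg: "(\<lambda>n. (\<Sum>k\<le>n. g (- 1 - int k)) * h (- 1 - int n))
      sums ((- 1) ^ (p + q) * euler_S (- a) p q (inverse y) (x * y))" by simp

  have "(\<lambda>n. (- 1) ^ (p + q) * (x ^ Suc n / (of_nat n + (1 - a)) ^ (p + q)))
      sums ((- 1) ^ (p + q) * Li_Hurwitz (p + q) x (1 - a))"
    by (intro sums_mult Li_Hurwitz_sums a_nat' nx) (use assms in auto)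
  moreover have "(- 1) ^ (p + q) * (x ^ Suc n / (of_nat n + (1 - a)) ^ (p + q))
      = g (- 1 - int n) * h (- 1 - int n)" for n
  proof -
    have "inverse y * (x * y) = x" using y0 by simp
    then have "inverse y ^ Suc n * (x * y) ^ Suc n = x ^ Suc n"
      by (simp only: power_mult_distrib[symmetric])
    moreover have "(- 1) ^ p * (u / c ^ p) * ((- 1) ^ q * (v / c ^ q)) = (- 1) ^ (p + q) * (u * v / c ^ (p + q))"
      for u v c :: complex by (simp add: power_add)
    ultimately show ?thesis by (simp only: g_neg h_neg)
  qed
  ultimately have diag: "(\<lambda>n. g (- 1 - int n) * h (- 1 - int n))
      sums ((- 1) ^ (p + q) * Li_Hurwitz (p + q) x (1 - a))" by (simp only:)

  have T_quadrants: "T \<longlonglongrightarrow>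
      (inverse y * Li_Hurwitz p y a) * ((x * y) * Li_Hurwitz q (inverse (x * y)) a)
      - x * euler_S (a - 1) p q y (inverse (x * y))
      + (inverse y * Li_Hurwitz p y a) * ((- 1) ^ q * Li_Hurwitz q (x * y) (1 - a))
      + (- 1) ^ (p + q) * euler_S (- a) p q (inverse y) (x * y)
      - (- 1) ^ (p + q) * Li_Hurwitz (p + q) x (1 - a)"
    unfolding T_def sum_int_strict_triangle
    by (intro tendsto_add tendsto_diff tendsto_mult
        g_pos_sums[unfolded sums_def] h_pos_sums[unfolded sums_def] h_neg_sums[unfolded sums_def]
        S_pos[unfolded sums_def] S_neg[unfolded sums_def] diag[unfolded sums_def])

  \<comment> \<open>Second evaluation of the triangle: differences\<close>
  have f_tail_pos: "\<exists>C. tail_bound (\<lambda>n. f i (int n)) C" if "i \<ge> 1" for i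
  proof -
    obtain C where "tail_bound (\<lambda>n. 1 / (of_nat n + a) ^ i * inverse x ^ n) C"
      using decay_tail_bound[OF decay_inverse_shifted_power[OF a_nat \<open>i \<ge> 1\<close>] ni(1)] assms(3) by auto
    then show ?thesis by (auto simp: f_def)
  qed
  have f_tail_neg: "\<exists>C. tail_bound (\<lambda>n. f i (- 1 - int n)) C" if "i \<ge> 1" for i
  proof -
    obtain C where "tail_bound (\<lambda>n. 1 / (of_nat n + (1 - a)) ^ i * x ^ n) C"
      using decay_tail_bound[OF decay_inverse_shifted_power[OF a_nat' \<open>i \<ge> 1\<close>] nx assms(3)] by auto
    from tail_bound_cmult[OF this, of "(- 1) ^ i * x"] show ?thesis
      unfolding f_neg by (auto simp: mult.assoc)
  qed
  define W where "W M j = {- int M..<int M - int j}" for M j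
  have Li_weight: "norm (w ^ j / of_nat j ^ s) \<le> 1 / real j" if "norm w = 1" "s \<ge> 1" "j \<ge> 1" for w :: complex and s j
  proof -
    have "real j \<le> real j ^ s" using that self_le_power[of "real j" s] by simp
    then show ?thesis using that by (simp add: norm_divide norm_power divide_left_mono)
  qed
  have lim: "(\<lambda>M. \<Sum>j=1..<2*M. w ^ j / of_nat j ^ s * (\<Sum>n\<in>W M j. f i n)) \<longlonglongrightarrow> Li s w * B i"
    if "norm w = 1" "s \<ge> 1" "(s, w) \<noteq> (1, 1)" "i \<ge> 1" for w s i
  proof -
    obtain C C' where "tail_bound (\<lambda>n. f i (int n)) C" "tail_bound (\<lambda>n. f i (- 1 - int n)) C'"
      using f_tail_pos f_tail_neg \<open>i \<ge> 1\<close> by blast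
    then show ?thesis unfolding B_def W_def using that
      by (intro weighted_window_sums_tendsto f_pos_sums f_neg_sums Li_weight Li_sums)
  qed
  \<comment> \<open>After reflection of the window, the limit lemma is applied to n -> f i (-1 - n),
    whose halves are those of \<open>f i\<close> interchanged; the bilateral sum stays
    \<open>B i\<close>.\<close>
  have lim_shift: "(\<lambda>M. \<Sum>j=1..<2*M. w ^ j / of_nat j ^ s * (\<Sum>n\<in>W M j. f i (n + int j))) \<longlonglongrightarrow> Li s w * B i"
    if "norm w = 1" "s \<ge> 1" "(s, w) \<noteq> (1, 1)" "i \<ge> 1" for w s i
  proof -
    obtain C C' where *: "tail_bound (\<lambda>n. f i (- 1 - int n)) C'" "tail_bound (\<lambda>n. f i (- 1 - (- 1 - int n))) C"
      using f_tail_pos[OF \<open>i \<ge> 1\<close>] f_tail_neg[OF \<open>i \<ge> 1\<close>] by auto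
    have **: "(\<lambda>n. f i (- 1 - (- 1 - int n))) sums (x * Li_Hurwitz i (inverse x) a)"
      using f_pos_sums[OF \<open>i \<ge> 1\<close>] by simp
    have "B i = (- 1) ^ i * Li_Hurwitz i x (1 - a) + x * Li_Hurwitz i (inverse x) a"
      by (simp add: B_def)
    then show ?thesis
      unfolding W_def int_interval_sum_reflect[of "f i"] using that
      by (simp only:) (intro weighted_window_sums_tendsto[where f = "\<lambda>n. f i (- 1 - n)", OF * _ **]
            f_neg_sums Li_weight Li_sums)
  qed

  have "T = (\<lambda>M. \<Sum>j=1..<2*M. \<Sum>n\<in>W M j. g (n + int j) * h n)"
    unfolding T_def W_def sum_int_strict_triangle_by_difference ..
  also have "\<dots> = (\<lambda>M. \<Sum>j=1..<2*M.
        (\<Sum>i\<le>P. (-1) ^ Suc Q * of_nat ((Q + i) choose Q) * ((x * y) ^ j / of_nat j ^ (Q + i + 1)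
          * (\<Sum>n\<in>W M j. f (P - i + 1) (n + int j))))
      + (\<Sum>i\<le>Q. (-1) ^ i * of_nat ((P + i) choose P) * (y ^ j / of_nat j ^ (P + i + 1)
          * (\<Sum>n\<in>W M j. f (Q - i + 1) n))))"
    unfolding g_def h_def f_def p q
    by (intro ext sum.cong refl window_convolution a_int x0 y0) auto
  also have "\<dots> = (\<lambda>M. (\<Sum>i\<le>P. (-1) ^ Suc Q * of_nat ((Q + i) choose Q) *
          (\<Sum>j=1..<2*M. (x * y) ^ j / of_nat j ^ (Q + i + 1) * (\<Sum>n\<in>W M j. f (P - i + 1) (n + int j))))
      + (\<Sum>i\<le>Q. (-1) ^ i * of_nat ((P + i) choose P) *
          (\<Sum>j=1..<2*M. y ^ j / of_nat j ^ (P + i + 1) * (\<Sum>n\<in>W M j. f (Q - i + 1) n))))"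
    unfolding sum.distrib sum_distrib_left[of "_ * _"]
    by (intro ext arg_cong2[where f = "(+)"] sum.swap)
  finally have T_eq: "T = \<dots>" .
  \<comment> \<open>The pair (1, 1) never occurs: Q + i + 1 = 1 forces q = 1 and then xy \<noteq> 1,
    while P + i + 1 = 1 forces p = 1 and then y \<noteq> 1.\<close>
  have T_differences: "T \<longlonglongrightarrow>
      (\<Sum>i\<le>P. (-1) ^ Suc Q * of_nat ((Q + i) choose Q) * (Li (Q + i + 1) (x * y) * B (P - i + 1)))
      + (\<Sum>i\<le>Q. (-1) ^ i * of_nat ((P + i) choose P) * (Li (P + i + 1) y * B (Q - i + 1)))"
    unfolding T_eq
    by (intro tendsto_add tendsto_sum tendsto_mult_left lim lim_shift nxy ny)
       (use assms(7,8) in \<open>auto simp: p q\<close>)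

  \<comment> \<open>Matching with the stated finite sums\<close>
  have R1: "(-1) ^ q * (\<Sum>m=0..p-1. of_nat ((p + q - m - 2) choose (q - 1))
            * ((-1) ^ m * Li_Hurwitz (m + 1) x (1 - a) - x * Li_Hurwitz (m + 1) (inverse x) a)
            * Li (p + q - m - 1) (x * y))
     = - (\<Sum>i\<le>P. (-1) ^ Suc Q * of_nat ((Q + i) choose Q) * (Li (Q + i + 1) (x * y) * B (P - i + 1)))"
    unfolding sum_distrib_left sum_negf[symmetric]
  proof (rule sum.reindex_bij_witness[of _ "\<lambda>i. P - i" "\<lambda>m. P - m"])
    fix m assume "m \<in> {0..p-1}"
    then have m: "m \<le> P" by (simp add: p)
    have 1: "p + q - m - 2 = Q + (P - m)" "p + q - m - 1 = Q + (P - m) + 1" "P - (P - m) + 1 = m + 1"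
      using m by (auto simp: p q)
    have 2: "(-1) ^ m * Li_Hurwitz (m + 1) x (1 - a) - x * Li_Hurwitz (m + 1) (inverse x) a = - B (m + 1)"
      by (simp add: B_def)
    show "- ((-1) ^ Suc Q * of_nat ((Q + (P - m)) choose Q)
          * (Li (Q + (P - m) + 1) (x * y) * B (P - (P - m) + 1)))
      = (-1) ^ q * (of_nat ((p + q - m - 2) choose (q - 1))
            * ((-1) ^ m * Li_Hurwitz (m + 1) x (1 - a) - x * Li_Hurwitz (m + 1) (inverse x) a)
            * Li (p + q - m - 1) (x * y))"
      unfolding 1 2 by (simp add: q)
  qed (auto simp: p)
  have R2: "(-1) ^ q * (\<Sum>m=0..q-1. of_nat ((p + q - m - 2) choose (p - 1))
            * ((-1) ^ m * x * Li_Hurwitz (m + 1) (inverse x) a - Li_Hurwitz (m + 1) x (1 - a))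
            * Li (p + q - m - 1) y)
     = - (\<Sum>i\<le>Q. (-1) ^ i * of_nat ((P + i) choose P) * (Li (P + i + 1) y * B (Q - i + 1)))"
    unfolding sum_distrib_left sum_negf[symmetric]
  proof (rule sum.reindex_bij_witness[of _ "\<lambda>i. Q - i" "\<lambda>m. Q - m"])
    fix m assume "m \<in> {0..q-1}"
    then have m: "m \<le> Q" by (simp add: q)
    have 1: "p + q - m - 2 = P + (Q - m)" "p + q - m - 1 = P + (Q - m) + 1" "Q - (Q - m) + 1 = m + 1"
      using m by (auto simp: p q)
    have 2: "(-1) ^ m * x * Li_Hurwitz (m + 1) (inverse x) a - Li_Hurwitz (m + 1) x (1 - a) = (-1) ^ m * B (m + 1)"
      by (cases "even m") (simp_all add: B_def)
    \<comment> \<open>Writing q = (Q - m) + m + 1 splits the sign so that its factor (-1)^m cancels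
      the one in front of \<open>B (m + 1)\<close>.\<close>
    have "(-1 :: complex) ^ q = (-1) ^ Suc (Q - m + m)" using m by (simp add: q)
    then have 3: "(-1 :: complex) ^ q = - ((-1) ^ (Q - m) * (-1) ^ m)" by (simp only: power_add power_Suc) simp
    have 4: "(-1 :: complex) ^ m * (-1) ^ m = 1" by (simp flip: power_mult_distrib)
    show "- ((-1) ^ (Q - m) * of_nat ((P + (Q - m)) choose P)
          * (Li (P + (Q - m) + 1) y * B (Q - (Q - m) + 1)))
      = (-1) ^ q * (of_nat ((p + q - m - 2) choose (p - 1))
            * ((-1) ^ m * x * Li_Hurwitz (m + 1) (inverse x) a - Li_Hurwitz (m + 1) x (1 - a))
            * Li (p + q - m - 1) y)"
      unfolding 1 2 3 using 4 by (simp add: p)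
  qed (auto simp: q)
  have sgn: "(-1 :: complex) ^ (p + q - 1) = - ((-1) ^ (p + q))" by (simp add: p q)
  have cancel_y: "inverse y * u * (x * y * v) = x * u * v" for u v
    using y0 by simp
  show ?thesis
    \<comment> \<open>The two limits of \<open>T\<close> agree; solving for the Euler sums moves the
      finite sums across, hence the minus signs in \<open>R1\<close> and \<open>R2\<close>.\<close>
    using LIMSEQ_unique[OF T_quadrants T_differences]
    unfolding R1 R2 sgn cancel_y by (simp add: algebra_simps del: inverse_mult_distrib)
qed

end
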